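(* Let $X=(X_n)_{n\ge 0}$ be the canonical process with values in $\{1,\dots,N\}$ on path space, let $\mathscr F_n=\sigma(X_0,X_1,\dots,X_n)$, and let $P_0=(P_0(i,j))_{1\le i,j\le N}$ be a transition probability matrix with $P_0(i,j)>0$ for all $i,j$. (Direct part.) Let $\mathbf P$ be a probability measure under which $X_n$ is a Markov chain with $(\mathscr F_n)$-predictable transition probability matrices $P_n$, $n\ge 1$. Suppose $\mathbf P_0$ is a probability measure with respect to which $X_n$ is the stationary Markov chain with transition probability matrix $P_0$ and the same initial distribution as under $\mathbf P$. Then $\mathbf P\ll\mathbf P_0$ and, for every $n$, $$\frac{d\mathbf P}{d\mathbf P_0}\Big|_{\sigma(X_0,X_1,\dots,X_n)}=\exp\left(\sum_{k=1}^n\log\frac{P_k(X_{k-1},X_k)}{P_0(X_{k-1},X_k)}\right).\tag{D}$$ (Converse part.) Let $\mathbf P$ be a probability measure on path space. If there exists a probability measure $\mathbf P_0$ with respect to which $X_n$ is the stationary Markov chain with transition probability matrix $P_0$ satisfying $P_0(i,j)>0$ for all $i,j$ and with the same initial distribution as under $\mathbf P$, and if $\mathbf P\ll\mathbf P_0$, then there exist $(\mathscr F_n)$-predictable transition probability matrices $P_n$, $n\ge1$, such that $X_n$ is a Markov chain with transition probability matrices $P_n$ under $\mathbf P$ and (D) holds for every $n$.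
   Context: The path space is equipped with the $\sigma$-algebra $\sigma\big(\bigcup_n\sigma(X_0,\dots,X_n)\big)$. A transition probability matrix is an $N\times N$ matrix with nonnegative entries and row sums $1$. Predictable means that $P_n$ is a (possibly random) transition probability matrix that is $\mathscr F_{n-1}$-measurable. $X_n$ is a Markov chain with (predictable) transition matrices $P_n$ under $\mathbf P$ if $\mathbf P(X_n=j\mid\mathscr F_{n-1})=P_n(X_{n-1},j)$ almost surely for all $n\ge 1$ and all $j$. "Stationary Markov chain with transition probability matrix $P_0$" refers to the time-homogeneous case, in which the transition matrix at every step is the constant matrix $P_0$. Convention: $\log 0=-\infty$ and $\exp(-\infty)=0$.
   Formalization: Absolute continuity of P with respect to P_0 is taken on each σ(X_0,…,X_n), not on the whole path σ-algebra, where the direct part fails (i.i.d. sequences with different laws are mutually singular); in the converse this only weakens the hypothesis. *)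

theory Defs
  imports "HOL-Probability.Probability"
begin

text \<open>
  The state space is a finite type \<^typ>\<open>'n\<close>, so that \<open>N = CARD('n)\<close>. A path is a function
  \<^typ>\<open>nat \<Rightarrow> 'n\<close>, and the \<open>(i, j)\<close> entry of a matrix \<open>A\<close> is \<open>A $ i $ j\<close>.
\<close>

definition X :: "nat \<Rightarrow> (nat \<Rightarrow> 'n) \<Rightarrow> 'n" where
  "X n \<omega> = \<omega> n"

definition \<F> :: "nat \<Rightarrow> (nat \<Rightarrow> 'n) measure" where
  "\<F> n = sigma UNIV {X k -` A | k A. k \<le> n}"

definition path_space :: "(nat \<Rightarrow> 'n) measure" where
  "path_space = sigma UNIV (\<Union>n. sets (\<F> n))"

definition path_prob :: "(nat \<Rightarrow> 'n) measure \<Rightarrow> bool" where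
  "path_prob P \<longleftrightarrow> prob_space P \<and> sets P = sets path_space"

definition transition_matrix :: "real^'n^'n \<Rightarrow> bool" where
  "transition_matrix A \<longleftrightarrow> (\<forall>i j. 0 \<le> A $ i $ j) \<and> (\<forall>i. (\<Sum>j\<in>UNIV. A $ i $ j) = 1)"

text \<open>In the next two definitions the value of \<open>Q\<close> at index 0 plays no role.\<close>

definition predictable_transition_matrices ::
    "(nat \<Rightarrow> (nat \<Rightarrow> 'n::finite) \<Rightarrow> real^'n^'n) \<Rightarrow> bool" where
  "predictable_transition_matrices Q \<longleftrightarrow>
     (\<forall>n\<ge>1. Q n \<in> borel_measurable (\<F> (n - 1)) \<and> (\<forall>\<omega>. transition_matrix (Q n \<omega>)))"

definition markov_chain ::
    "(nat \<Rightarrow> 'n) measure \<Rightarrow> (nat \<Rightarrow> (nat \<Rightarrow> 'n::finite) \<Rightarrow> real^'n^'n) \<Rightarrow> bool" where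
  "markov_chain P Q \<longleftrightarrow>
     (\<forall>n\<ge>1. \<forall>j. AE \<omega> in P.
        real_cond_exp P (\<F> (n - 1)) (indicator {\<omega>'. X n \<omega>' = j}) \<omega>
          = Q n \<omega> $ X (n - 1) \<omega> $ j)"

definition stationary_markov_chain ::
    "(nat \<Rightarrow> 'n::finite) measure \<Rightarrow> real^'n^'n \<Rightarrow> bool" where
  "stationary_markov_chain P A \<longleftrightarrow> markov_chain P (\<lambda>_ _. A)"

definition same_initial_distribution ::
    "(nat \<Rightarrow> 'n) measure \<Rightarrow> (nat \<Rightarrow> 'n) measure \<Rightarrow> bool" where
  "same_initial_distribution P P' \<longleftrightarrow>
     distr P (count_space UNIV) (X 0) = distr P' (count_space UNIV) (X 0)"

text \<open>
  Absolute continuity of \<open>P\<close> with respect to \<open>P'\<close> along the filtration, i.e. on every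
  \<open>\<F> n\<close>. On the full path \<open>\<sigma>\<close>-algebra a chain with predictable transition matrices need not be
  absolutely continuous: two i.i.d. sequences with distinct positive one-step laws are mutually
  singular by the strong law of large numbers. Absolute continuity on the full \<open>\<sigma>\<close>-algebra
  implies the local notion (lemma \<open>absolutely_continuous_imp_local\<close> below).
\<close>

definition locally_absolutely_continuous ::
    "(nat \<Rightarrow> 'n) measure \<Rightarrow> (nat \<Rightarrow> 'n) measure \<Rightarrow> bool" where
  "locally_absolutely_continuous P' P \<longleftrightarrow>
     (\<forall>n. absolutely_continuous (restr_to_subalg P' (\<F> n)) (restr_to_subalg P (\<F> n)))"

text \<open>
  Extended logarithm and exponential with \<open>log 0 = -\<infinity>\<close> and \<open>exp (-\<infinity>) = 0\<close>; the real \<^const>\<open>ln\<close>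
  has \<open>ln 0 = 0\<close> instead. \<open>elog\<close> is only meant for nonnegative arguments.
\<close>

definition elog :: "real \<Rightarrow> ereal" where
  "elog x = (if x = 0 then -\<infinity> else ereal (ln x))"

definition eexp :: "ereal \<Rightarrow> ennreal" where
  "eexp x = (case x of ereal r \<Rightarrow> ennreal (exp r) | PInfty \<Rightarrow> \<infinity> | MInfty \<Rightarrow> 0)"

lemma eexp_simps [simp]:
  "eexp (ereal r) = ennreal (exp r)" "eexp \<infinity> = \<infinity>" "eexp (-\<infinity>) = 0"
  by (simp_all add: eexp_def)

definition density_formula ::
    "(nat \<Rightarrow> 'n) measure \<Rightarrow> (nat \<Rightarrow> 'n) measure \<Rightarrow> real^'n^'n
      \<Rightarrow> (nat \<Rightarrow> (nat \<Rightarrow> 'n::finite) \<Rightarrow> real^'n^'n) \<Rightarrow> nat \<Rightarrow> bool" where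
  "density_formula P' P A Q n \<longleftrightarrow>
     (AE \<omega> in restr_to_subalg P' (\<F> n).
        RN_deriv (restr_to_subalg P' (\<F> n)) (restr_to_subalg P (\<F> n)) \<omega>
          = eexp (\<Sum>k=1..n. elog (Q k \<omega> $ X (k - 1) \<omega> $ X k \<omega> / A $ X (k - 1) \<omega> $ X k \<omega>)))"

lemma subalgebra_\<F>:
  assumes "path_prob P"
  shows "subalgebra P (\<F> n)"
proof -
  have sets: "sets P = sigma_sets UNIV (\<Union>n. sets (\<F> n))"
    using assms by (simp add: path_prob_def path_space_def)
  moreover have "space P = UNIV"
    using assms sets_eq_imp_space_eq[of P path_space]
    by (simp add: path_prob_def path_space_def space_measure_of_conv)
  moreover have "space (\<F> n) = UNIV"
    by (simp add: \<F>_def space_measure_of_conv)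
  ultimately show ?thesis
    by (auto simp: subalgebra_def)
qed

lemma absolutely_continuous_imp_local:
  assumes "path_prob P'" "path_prob P" "absolutely_continuous P' P"
  shows "locally_absolutely_continuous P' P"
  using assms(3)
  by (auto simp: locally_absolutely_continuous_def absolutely_continuous_def
      null_sets_restr_to_subalg[OF subalgebra_\<F>[OF assms(1)]]
      null_sets_restr_to_subalg[OF subalgebra_\<F>[OF assms(2)]])

end

theory Submission
  imports Defs
begin

text \<open>
  Since the state space is finite, \<open>\<F> n\<close> is the \<sigma>-algebra of a finite partition: its atoms are
  the cylinders that fix the coordinates \<open>0, \<dots>, n\<close>. A function is \<open>\<F> n\<close>-measurable exactly when it
  is constant on these cylinders, and an almost sure statement about such functions holds exactly
  when it holds on every cylinder of positive mass. Conditional expectations and Radon-Nikodym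
  derivatives with respect to \<open>\<F> n\<close> therefore become quotients of cylinder masses, and the whole
  theorem becomes a statement about the numbers \<open>P (cylinder n \<omega>)\<close>.

  In these terms the Markov property with predictable matrices \<open>Q\<close> says that passing from
  \<open>cylinder n \<omega>\<close> to \<open>cylinder (n + 1) \<omega>\<close> multiplies the mass by the corresponding entry of
  \<open>Q (n + 1) \<omega>\<close> (\<open>markov_chain_iff_cylinder\<close>). Hence the mass of a cylinder is its initial mass
  times a product of transition probabilities. Dividing the products for the two chains, whose
  initial masses agree, gives the density; the positive entries of the reference matrix make the
  division legitimate and give absolute continuity on each \<open>\<F> n\<close> (\<open>direct_part\<close>).

  For the converse, every probability measure on path space is a Markov chain with respect to its
  own one-step conditional probabilities given the past. Since predictable matrices may depend on
  the whole past, these quotients of cylinder masses form such matrices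
  (\<open>markov_chain_own_conditional_probabilities\<close>), and the density formula is again the one of the
  direct part.
\<close>

section \<open>Cylinders as the atoms of the filtration\<close>

definition cylinder :: "nat \<Rightarrow> (nat \<Rightarrow> 'n) \<Rightarrow> (nat \<Rightarrow> 'n) set" where
  "cylinder n \<omega> = {\<omega>'. \<forall>k\<le>n. \<omega>' k = \<omega> k}"

lemma self_in_cylinder [simp]: "\<omega> \<in> cylinder n \<omega>"
  by (simp add: cylinder_def)

lemma cylinder_eq: "\<omega>' \<in> cylinder n \<omega> \<Longrightarrow> cylinder n \<omega>' = cylinder n \<omega>"
  by (auto simp: cylinder_def)

lemma cylinder_Suc: "cylinder (Suc n) \<omega> = cylinder n \<omega> \<inter> {\<omega>'. \<omega>' (Suc n) = \<omega> (Suc n)}"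
  by (auto simp: cylinder_def le_Suc_eq)

text \<open>
  A cylinder depends only on the restriction of the path to \<open>{..n}\<close>, and there are finitely many
  such restrictions.
\<close>

lemma finite_range_cylinder: "finite (range (cylinder n :: (nat \<Rightarrow> 'n::finite) \<Rightarrow> _))"
proof -
  have "cylinder n \<omega> \<in> cylinder n ` (PiE {..n} (\<lambda>_. UNIV))" for \<omega> :: "nat \<Rightarrow> 'n"
  proof
    show "cylinder n \<omega> = cylinder n (restrict \<omega> {..n})" by (simp add: cylinder_def)
  qed simp
  then have "range (cylinder n :: (nat \<Rightarrow> 'n) \<Rightarrow> _) \<subseteq> cylinder n ` (PiE {..n} (\<lambda>_. UNIV))" by blast
  then show ?thesis
    by (rule finite_subset) (intro finite_imageI finite_PiE, auto)
qed

lemma space_\<F> [simp]: "space (\<F> n) = UNIV"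
  by (simp add: \<F>_def space_measure_of_conv)

lemma coordinate_event_in_\<F>: "k \<le> n \<Longrightarrow> {\<omega>. \<omega> k = j} \<in> sets (\<F> n)"
proof -
  assume "k \<le> n"
  moreover have "{\<omega>. \<omega> k = j} = X k -` {j}" by (auto simp: X_def)
  ultimately show ?thesis by (auto simp: \<F>_def sets_measure_of_conv intro!: sigma_sets.Basic)
qed

lemma cylinder_in_\<F>: "cylinder n \<omega> \<in> sets (\<F> n)"
proof -
  have "cylinder n \<omega> = space (\<F> n) \<inter> (\<Inter>k\<in>{..n}. {\<omega>'. \<omega>' k = \<omega> k})"
    by (auto simp: cylinder_def)
  also have "\<dots> \<in> sets (\<F> n)"
    by (intro sets.Int sets.top sets.finite_INT) (auto intro: coordinate_event_in_\<F>)
  finally show ?thesis .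
qed

text \<open>
  Being a union of cylinders is preserved by complements and countable unions, and it holds for
  the generators. Conversely a union of cylinders is a finite union, because there are only
  finitely many of them.
\<close>

lemma sets_\<F>_iff:
  fixes A :: "(nat \<Rightarrow> 'n::finite) set"
  shows "A \<in> sets (\<F> n) \<longleftrightarrow> (\<forall>\<omega>\<in>A. cylinder n \<omega> \<subseteq> A)"
proof
  assume "A \<in> sets (\<F> n)"
  then have "A \<in> sigma_sets UNIV {X k -` A | k A. k \<le> n}"
    by (simp add: \<F>_def sets_measure_of_conv)
  then have "\<forall>\<omega> \<omega>'. \<omega>' \<in> cylinder n \<omega> \<longrightarrow> (\<omega>' \<in> A \<longleftrightarrow> \<omega> \<in> A)"
  proof induction
    case (Basic a)
    then show ?case by (auto simp: cylinder_def X_def)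
  qed auto
  then show "\<forall>\<omega>\<in>A. cylinder n \<omega> \<subseteq> A" by blast
next
  assume *: "\<forall>\<omega>\<in>A. cylinder n \<omega> \<subseteq> A"
  have "\<Union> (cylinder n ` A) \<in> sets (\<F> n)"
    by (rule sets.finite_Union)
       (auto intro: finite_subset[OF _ finite_range_cylinder] cylinder_in_\<F>)
  moreover have "\<Union> (cylinder n ` A) = A"
    using * by force
  ultimately show "A \<in> sets (\<F> n)" by simp
qed

text \<open>
  The level set of \<open>f\<close> through \<open>\<omega>\<close> lies in \<open>\<F> n\<close>, hence contains the whole cylinder around \<open>\<omega>\<close>.
  The \<open>t1_space\<close> class makes singletons Borel and covers matrices, \<^typ>\<open>real\<close> and \<^typ>\<open>ennreal\<close>
  at once.
\<close>

lemma \<F>_measurable_imp_constant_on_cylinder: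
  fixes f :: "(nat \<Rightarrow> 'n::finite) \<Rightarrow> 'b::t1_space"
  assumes "f \<in> borel_measurable (\<F> n)" "\<omega>' \<in> cylinder n \<omega>"
  shows "f \<omega>' = f \<omega>"
proof -
  have "f -` {f \<omega>} \<inter> space (\<F> n) \<in> sets (\<F> n)"
    by (rule measurable_sets[OF assms(1)]) simp
  then have "cylinder n \<omega> \<subseteq> f -` {f \<omega>}"
    by (auto simp: sets_\<F>_iff)
  with assms(2) show ?thesis by auto
qed

lemma constant_on_cylinders_imp_\<F>_measurable:
  fixes f :: "(nat \<Rightarrow> 'n::finite) \<Rightarrow> 'b"
  assumes "\<And>\<omega> \<omega>'. \<omega>' \<in> cylinder n \<omega> \<Longrightarrow> f \<omega>' = f \<omega>" "\<And>\<omega>. f \<omega> \<in> space N"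
  shows "f \<in> measurable (\<F> n) N"
proof (rule measurableI)
  fix A assume "A \<in> sets N"
  show "f -` A \<inter> space (\<F> n) \<in> sets (\<F> n)"
    unfolding sets_\<F>_iff using assms(1) by fastforce
qed (use assms(2) in auto)

text \<open>
  The cylinders of mass zero are finitely many, so their union is a null set, while a cylinder of
  positive mass cannot be contained in a null set. This turns almost sure statements into
  pointwise ones. It is stated for an arbitrary measure whose \<sigma>-algebra contains \<open>\<F> n\<close>, so that
  it applies to a path measure and to its restriction to \<open>\<F> n\<close> alike.
\<close>

lemma AE_iff_on_cylinders:
  fixes M :: "(nat \<Rightarrow> 'n::finite) measure"
  assumes "finite_measure M" and sub: "subalgebra M (\<F> n)"
    and const: "\<And>\<omega> \<omega>'. \<omega>' \<in> cylinder n \<omega> \<Longrightarrow> \<phi> \<omega>' \<longleftrightarrow> \<phi> \<omega>"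
  shows "(AE \<omega> in M. \<phi> \<omega>) \<longleftrightarrow> (\<forall>\<omega>. measure M (cylinder n \<omega>) > 0 \<longrightarrow> \<phi> \<omega>)"
proof -
  interpret finite_measure M by fact
  have cyl: "cylinder n \<omega> \<in> sets M" for \<omega>
    using sub cylinder_in_\<F>[of n \<omega>] by (auto simp: subalgebra_def)
  have sp: "space M = UNIV" using sub by (simp add: subalgebra_def)
  show ?thesis
  proof safe
    fix \<omega> assume ae: "AE \<omega> in M. \<phi> \<omega>" and pos: "measure M (cylinder n \<omega>) > 0"
    show "\<phi> \<omega>"
    proof (rule ccontr)
      assume "\<not> \<phi> \<omega>"
      from ae have "AE \<omega>' in M. \<omega>' \<notin> cylinder n \<omega>"
        by eventually_elim (use \<open>\<not> \<phi> \<omega>\<close> const in auto)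
      then have "emeasure M (cylinder n \<omega>) = 0"
        using cyl by (simp add: AE_iff_null_sets[symmetric] null_sets_def AE_iff_measurable sp)
      then show False using pos by (simp add: measure_def)
    qed
  next
    assume *: "\<forall>\<omega>. measure M (cylinder n \<omega>) > 0 \<longrightarrow> \<phi> \<omega>"
    let ?N = "\<Union>{C \<in> range (cylinder n). measure M C = 0}"
    have "?N \<in> null_sets M"
      using finite_range_cylinder[of n] cyl
      by (intro null_sets.finite_Union) (auto simp: null_sets_def emeasure_eq_measure)
    then show "AE \<omega> in M. \<phi> \<omega>"
    proof (rule AE_I', safe)
      fix \<omega> assume "\<not> \<phi> \<omega>"
      with * have "measure M (cylinder n \<omega>) = 0" by (metis measure_nonneg less_eq_real_def)
      then show "\<omega> \<in> ?N" using self_in_cylinder by blast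
    qed
  qed
qed

section \<open>The Markov property in terms of cylinder masses\<close>

text \<open>
  Integrate the conditional expectation, which is constant on the cylinder, over the cylinder. The
  product form avoids a case distinction on cylinders of mass zero.
\<close>

lemma real_cond_exp_on_cylinder:
  fixes P :: "(nat \<Rightarrow> 'n::finite) measure"
  assumes "path_prob P" and A: "A \<in> sets P"
  shows "real_cond_exp P (\<F> n) (indicator A) \<omega> * measure P (cylinder n \<omega>)
           = measure P (cylinder n \<omega> \<inter> A)"
proof -
  interpret prob_space P using assms by (simp add: path_prob_def)
  have sub: "subalgebra P (\<F> n)" by (rule subalgebra_\<F>) fact
  interpret finite_measure_subalgebra P "\<F> n" by unfold_locales fact
  let ?C = "cylinder n \<omega>" and ?g = "real_cond_exp P (\<F> n) (indicator A)"
  have C: "?C \<in> sets P" using sub cylinder_in_\<F>[of n \<omega>] by (auto simp: subalgebra_def)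
  have "measure P (?C \<inter> A) = (\<integral>x\<in>?C. indicator A x \<partial>P)"
    using A C by (simp add: set_lebesgue_integral_def indicator_inter_arith[symmetric])
  also have "\<dots> = (\<integral>x\<in>?C. ?g x \<partial>P)"
    using A by (intro real_cond_exp_intA cylinder_in_\<F>) (auto simp: emeasure_eq_measure)
  also have "\<dots> = (\<integral>x\<in>?C. ?g \<omega> \<partial>P)"
    using \<F>_measurable_imp_constant_on_cylinder[OF borel_measurable_cond_exp]
    by (intro set_lebesgue_integral_cong C) blast
  also have "\<dots> = ?g \<omega> * measure P ?C"
    using C by (simp add: set_integral_const emeasure_eq_measure)
  finally show ?thesis by simp
qed

lemma path_prob_coordinate_event: "path_prob P \<Longrightarrow> {\<omega>. \<omega> n = j} \<in> sets P"
  using subalgebra_\<F>[of P n] coordinate_event_in_\<F>[of n n j] by (auto simp: subalgebra_def)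

text \<open>
  Both sides of the defining equation of a Markov chain are constant on the cylinders up to
  time \<open>n\<close>, so it has to be checked only on those of positive mass; there, multiplying by the mass of
  the cylinder gives the claimed identity. On a cylinder of mass zero the identity is trivial.
\<close>

lemma markov_chain_iff_cylinder:
  fixes P :: "(nat \<Rightarrow> 'n::finite) measure"
  assumes P: "path_prob P" and Q: "\<And>n. Q (Suc n) \<in> borel_measurable (\<F> n)"
  shows "markov_chain P Q \<longleftrightarrow>
    (\<forall>n \<omega>. measure P (cylinder (Suc n) \<omega>)
              = measure P (cylinder n \<omega>) * Q (Suc n) \<omega> $ \<omega> n $ \<omega> (Suc n))"
proof -
  interpret prob_space P using P by (simp add: path_prob_def)
  let ?E = "\<lambda>n j. {\<omega>. \<omega> (Suc n) = j}"
  let ?g = "\<lambda>n j. real_cond_exp P (\<F> n) (indicator (?E n j))"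
  have "(AE \<omega> in P. ?g n j \<omega> = Q (Suc n) \<omega> $ \<omega> n $ j) \<longleftrightarrow>
        (\<forall>\<omega>. measure P (cylinder n \<omega> \<inter> ?E n j)
            = measure P (cylinder n \<omega>) * Q (Suc n) \<omega> $ \<omega> n $ j)" for n j
  proof -
    have "(AE \<omega> in P. ?g n j \<omega> = Q (Suc n) \<omega> $ \<omega> n $ j) \<longleftrightarrow>
       (\<forall>\<omega>. measure P (cylinder n \<omega>) > 0 \<longrightarrow> ?g n j \<omega> = Q (Suc n) \<omega> $ \<omega> n $ j)"
    proof (rule AE_iff_on_cylinders)
      fix \<omega> \<omega>' :: "nat \<Rightarrow> 'n" assume *: "\<omega>' \<in> cylinder n \<omega>"
      have "Q (Suc n) \<omega>' = Q (Suc n) \<omega>" "?g n j \<omega>' = ?g n j \<omega>"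
        by (intro \<F>_measurable_imp_constant_on_cylinder[OF _ *] Q borel_measurable_cond_exp)+
      moreover have "\<omega>' n = \<omega> n" using * by (simp add: cylinder_def)
      ultimately show "(?g n j \<omega>' = Q (Suc n) \<omega>' $ \<omega>' n $ j) = (?g n j \<omega> = Q (Suc n) \<omega> $ \<omega> n $ j)"
        by simp
    qed (use subalgebra_\<F>[OF P] in \<open>auto intro: finite_measure\<close>, unfold_locales)
    also have "\<dots> \<longleftrightarrow> (\<forall>\<omega>. measure P (cylinder n \<omega> \<inter> ?E n j)
            = measure P (cylinder n \<omega>) * Q (Suc n) \<omega> $ \<omega> n $ j)"
    proof (intro all_cong1)
      fix \<omega>
      show "(0 < measure P (cylinder n \<omega>) \<longrightarrow> ?g n j \<omega> = Q (Suc n) \<omega> $ \<omega> n $ j) =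
         (measure P (cylinder n \<omega> \<inter> ?E n j) = measure P (cylinder n \<omega>) * Q (Suc n) \<omega> $ \<omega> n $ j)"
        using real_cond_exp_on_cylinder[OF P path_prob_coordinate_event[OF P, of "Suc n" j], of n \<omega>]
        by (cases "measure P (cylinder n \<omega>) = 0") (auto simp: zero_less_measure_iff mult.commute)
    qed
    finally show ?thesis .
  qed
  moreover have "(\<forall>n\<ge>1. \<phi> n) \<longleftrightarrow> (\<forall>n. \<phi> (Suc n))" for \<phi> :: "nat \<Rightarrow> bool"
    by (auto simp: Suc_le_eq gr0_conv_Suc)
  ultimately have "markov_chain P Q \<longleftrightarrow> (\<forall>n j \<omega>. measure P (cylinder n \<omega> \<inter> ?E n j)
            = measure P (cylinder n \<omega>) * Q (Suc n) \<omega> $ \<omega> n $ j)"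
    by (simp add: markov_chain_def X_def)
  also have "\<dots> \<longleftrightarrow> (\<forall>n \<omega>. measure P (cylinder (Suc n) \<omega>)
              = measure P (cylinder n \<omega>) * Q (Suc n) \<omega> $ \<omega> n $ \<omega> (Suc n))" (is "?L \<longleftrightarrow> ?R")
  proof
    assume ?R
    show ?L
    proof (intro allI)
      fix n j and \<omega> :: "nat \<Rightarrow> 'n"
      \<comment> \<open>Changing the coordinate \<open>n + 1\<close> does not leave the cylinder up to time \<open>n\<close>, so the identity
        for the next state of \<open>\<omega>\<close> gives the identity for every next state \<open>j\<close>.\<close>
      let ?\<omega>' = "fun_upd \<omega> (Suc n) j"
      have *: "?\<omega>' \<in> cylinder n \<omega>" by (simp add: cylinder_def)
      show "measure P (cylinder n \<omega> \<inter> ?E n j) = measure P (cylinder n \<omega>) * Q (Suc n) \<omega> $ \<omega> n $ j"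
        using \<open>?R\<close>[rule_format, of n ?\<omega>'] cylinder_eq[OF *]
          \<F>_measurable_imp_constant_on_cylinder[OF Q *]
        by (simp add: cylinder_Suc)
    qed
  qed (simp add: cylinder_Suc)
  finally show ?thesis .
qed

lemma measure_cylinder_eq_prod:
  fixes P :: "(nat \<Rightarrow> 'n::finite) measure"
  assumes "path_prob P" "\<And>n. Q (Suc n) \<in> borel_measurable (\<F> n)" "markov_chain P Q"
  shows "measure P (cylinder n \<omega>)
           = measure P (cylinder 0 \<omega>) * (\<Prod>k=1..n. Q k \<omega> $ \<omega> (k - 1) $ \<omega> k)"
proof (induction n)
  case (Suc n)
  then show ?case using markov_chain_iff_cylinder[of P Q] assms by (simp add: mult.assoc)
qed simp

section \<open>The exponential of a sum of extended logarithms\<close>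

lemma elog_neq_PInfty: "elog x \<noteq> \<infinity>"
  by (simp add: elog_def)

text \<open>
  The value \<open>\<infinity>\<close> is excluded because \<open>\<infinity> + (-\<infinity>) = \<infinity>\<close> in \<^typ>\<open>ereal\<close> whereas
  \<open>\<infinity> * 0 = 0\<close> in \<^typ>\<open>ennreal\<close>.
\<close>

lemma eexp_add: "a \<noteq> \<infinity> \<Longrightarrow> b \<noteq> \<infinity> \<Longrightarrow> eexp (a + b) = eexp a * eexp b"
  by (cases a; cases b) (auto simp: exp_add ennreal_mult)

lemma eexp_elog: "0 \<le> x \<Longrightarrow> eexp (elog x) = ennreal x"
  by (auto simp: elog_def)

lemma eexp_sum_elog:
  assumes "finite S" "\<And>k. k \<in> S \<Longrightarrow> 0 \<le> f k"
  shows "eexp (\<Sum>k\<in>S. elog (f k)) = ennreal (\<Prod>k\<in>S. f k)"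
  using assms
proof (induction S rule: finite_induct)
  case empty
  show ?case by (simp add: zero_ereal_def)
next
  case (insert k S)
  then show ?case
    by (simp add: eexp_add eexp_elog elog_neq_PInfty sum_Pinfty ennreal_mult prod_nonneg)
qed

section \<open>Absolute continuity and densities in terms of cylinder masses\<close>

lemma restr_to_\<F>:
  fixes P :: "(nat \<Rightarrow> 'n::finite) measure"
  assumes "path_prob P"
  shows "finite_measure (restr_to_subalg P (\<F> n))"
    "subalgebra (restr_to_subalg P (\<F> n)) (\<F> n)"
    "measure (restr_to_subalg P (\<F> n)) (cylinder n \<omega>) = measure P (cylinder n \<omega>)"
    "emeasure (restr_to_subalg P (\<F> n)) (cylinder n \<omega>) = emeasure P (cylinder n \<omega>)"
proof -
  interpret prob_space P using assms by (simp add: path_prob_def)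
  have sub: "subalgebra P (\<F> n)" by (rule subalgebra_\<F>) fact
  show "finite_measure (restr_to_subalg P (\<F> n))"
    by (rule finite_measure_restr_to_subalg[OF sub]) unfold_locales
  show "subalgebra (restr_to_subalg P (\<F> n)) (\<F> n)"
    using sub by (auto simp: subalgebra_def space_restr_to_subalg sets_restr_to_subalg[OF sub])
  show "emeasure (restr_to_subalg P (\<F> n)) (cylinder n \<omega>) = emeasure P (cylinder n \<omega>)"
    by (rule emeasure_restr_to_subalg[OF sub cylinder_in_\<F>])
  then show "measure (restr_to_subalg P (\<F> n)) (cylinder n \<omega>) = measure P (cylinder n \<omega>)"
    by (simp add: measure_def)
qed

text \<open>
  A set in \<open>\<F> n\<close> is null exactly when all cylinders contained in it have mass zero.
\<close>

lemma locally_absolutely_continuous_iff_cylinder: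
  fixes P P' :: "(nat \<Rightarrow> 'n::finite) measure"
  assumes P: "path_prob P" and P': "path_prob P'"
  shows "locally_absolutely_continuous P' P \<longleftrightarrow>
    (\<forall>n \<omega>. measure P' (cylinder n \<omega>) = 0 \<longrightarrow> measure P (cylinder n \<omega>) = 0)"
proof -
  have null: "A \<in> null_sets (restr_to_subalg R (\<F> n)) \<longleftrightarrow>
      A \<in> sets (\<F> n) \<and> (\<forall>\<omega>\<in>A. measure R (cylinder n \<omega>) = 0)"
    if R: "path_prob R" for R :: "(nat \<Rightarrow> 'n) measure" and A n
  proof (cases "A \<in> sets (\<F> n)")
    case True
    have "\<omega>' \<in> A \<longleftrightarrow> \<omega> \<in> A" if "\<omega>' \<in> cylinder n \<omega>" for \<omega> \<omega>'
      using True that cylinder_eq[OF that] self_in_cylinder unfolding sets_\<F>_iff by blast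
    then have "(AE \<omega> in restr_to_subalg R (\<F> n). \<omega> \<notin> A) \<longleftrightarrow>
        (\<forall>\<omega>. measure R (cylinder n \<omega>) > 0 \<longrightarrow> \<omega> \<notin> A)"
      using AE_iff_on_cylinders[OF restr_to_\<F>(1,2)[OF R], where \<phi> = "\<lambda>\<omega>. \<omega> \<notin> A"]
      by (simp add: restr_to_\<F>(3)[OF R])
    moreover have "A \<in> null_sets (restr_to_subalg R (\<F> n)) \<longleftrightarrow>
        (AE \<omega> in restr_to_subalg R (\<F> n). \<omega> \<notin> A)"
      using True by (intro AE_iff_null_sets) (simp add: sets_restr_to_subalg[OF subalgebra_\<F>[OF R]])
    ultimately show ?thesis using True by (auto simp: zero_less_measure_iff)
  qed (auto simp: null_sets_def sets_restr_to_subalg[OF subalgebra_\<F>[OF R]])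
  show ?thesis
    unfolding locally_absolutely_continuous_def absolutely_continuous_def
  proof safe
    fix n and \<omega> :: "nat \<Rightarrow> 'n"
    assume *: "\<forall>n. null_sets (restr_to_subalg P' (\<F> n)) \<subseteq> null_sets (restr_to_subalg P (\<F> n))"
      and "measure P' (cylinder n \<omega>) = 0"
    then have "cylinder n \<omega> \<in> null_sets (restr_to_subalg P' (\<F> n))"
      using cylinder_in_\<F> cylinder_eq by (fastforce simp: null[OF P'])
    with * have "cylinder n \<omega> \<in> null_sets (restr_to_subalg P (\<F> n))" by blast
    then show "measure P (cylinder n \<omega>) = 0" using self_in_cylinder by (simp add: null[OF P])
  qed (auto simp: null[OF P] null[OF P'])
qed

text \<open>
  The derivative is \<open>\<F> n\<close>-measurable, so it is constant on the cylinder and its integral there is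
  a product.
\<close>

lemma RN_deriv_on_cylinder:
  fixes P P' :: "(nat \<Rightarrow> 'n::finite) measure"
  assumes P: "path_prob P" and P': "path_prob P'" and ac: "locally_absolutely_continuous P' P"
  shows "emeasure P (cylinder n \<omega>) =
    RN_deriv (restr_to_subalg P' (\<F> n)) (restr_to_subalg P (\<F> n)) \<omega> * emeasure P' (cylinder n \<omega>)"
proof -
  let ?M' = "restr_to_subalg P' (\<F> n)" and ?M = "restr_to_subalg P (\<F> n)"
  let ?C = "cylinder n \<omega>" and ?f = "RN_deriv ?M' ?M"
  interpret M': finite_measure ?M' by (rule restr_to_\<F>) fact
  have sets: "sets ?M' = sets (\<F> n)" "sets ?M = sets (\<F> n)"
    using sets_restr_to_subalg subalgebra_\<F> P P' by blast+
  have f: "?f \<in> borel_measurable (\<F> n)"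
    using borel_measurable_RN_deriv[of ?M' ?M] sets(1) by (simp cong: measurable_cong_sets)
  have "?M = density ?M' ?f"
    using ac sets by (intro M'.density_RN_deriv[symmetric])
      (auto simp: locally_absolutely_continuous_def)
  then have "emeasure ?M ?C = emeasure (density ?M' ?f) ?C" by simp
  also have "\<dots> = (\<integral>\<^sup>+ x. ?f x * indicator ?C x \<partial>?M')"
    using cylinder_in_\<F> sets by (intro emeasure_density) auto
  also have "\<dots> = (\<integral>\<^sup>+ x. ?f \<omega> * indicator ?C x \<partial>?M')"
    using \<F>_measurable_imp_constant_on_cylinder[OF f]
    by (intro nn_integral_cong) (metis indicator_simps(2) mult_zero_right)
  also have "\<dots> = ?f \<omega> * emeasure ?M' ?C"
    using cylinder_in_\<F> sets by (intro nn_integral_cmult_indicator) auto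
  finally show ?thesis by (simp add: restr_to_\<F> P P')
qed

text \<open>
  On a cylinder with positive mass under \<open>P'\<close> the derivative is the quotient of the two masses,
  and the exponential in the density formula is the product of the quotients of transition
  probabilities.
\<close>

lemma density_formula_iff_cylinder:
  fixes P P' :: "(nat \<Rightarrow> 'n::finite) measure"
  assumes P: "path_prob P" and P': "path_prob P'" and ac: "locally_absolutely_continuous P' P"
    and Q: "predictable_transition_matrices Q" and A: "\<And>i j. 0 \<le> A $ i $ j"
  shows "density_formula P' P A Q n \<longleftrightarrow>
    (\<forall>\<omega>. measure P' (cylinder n \<omega>) > 0 \<longrightarrow> measure P (cylinder n \<omega>) =
      (\<Prod>k=1..n. Q k \<omega> $ \<omega> (k - 1) $ \<omega> k / A $ \<omega> (k - 1) $ \<omega> k) * measure P' (cylinder n \<omega>))"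
proof -
  interpret P: prob_space P using P by (simp add: path_prob_def)
  interpret P': prob_space P' using P' by (simp add: path_prob_def)
  let ?M' = "restr_to_subalg P' (\<F> n)" and ?M = "restr_to_subalg P (\<F> n)"
  let ?f = "RN_deriv ?M' ?M"
  let ?q = "\<lambda>\<omega>. \<Prod>k=1..n. Q k \<omega> $ \<omega> (k - 1) $ \<omega> k / A $ \<omega> (k - 1) $ \<omega> k"
  have nonneg: "0 \<le> Q k \<omega> $ i $ j" if "k \<ge> 1" for k \<omega> i j
    using Q that by (auto simp: predictable_transition_matrices_def transition_matrix_def)
  have q: "0 \<le> ?q \<omega>" for \<omega> by (intro prod_nonneg ballI divide_nonneg_nonneg nonneg A) simp
  have "density_formula P' P A Q n \<longleftrightarrow> (AE \<omega> in ?M'. ?f \<omega> = ennreal (?q \<omega>))"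
    unfolding density_formula_def X_def
    by (subst eexp_sum_elog) (auto intro!: divide_nonneg_nonneg nonneg A)
  also have "\<dots> \<longleftrightarrow> (\<forall>\<omega>. measure ?M' (cylinder n \<omega>) > 0 \<longrightarrow> ?f \<omega> = ennreal (?q \<omega>))"
  proof (rule AE_iff_on_cylinders[OF restr_to_\<F>(1,2)[OF P']])
    fix \<omega> \<omega>' :: "nat \<Rightarrow> 'n" assume *: "\<omega>' \<in> cylinder n \<omega>"
    have "?f \<in> borel_measurable (\<F> n)"
      using borel_measurable_RN_deriv[of ?M' ?M] sets_restr_to_subalg[OF subalgebra_\<F>[OF P']]
      by (simp cong: measurable_cong_sets)
    then have "?f \<omega>' = ?f \<omega>" using * by (rule \<F>_measurable_imp_constant_on_cylinder)
    moreover have "?q \<omega>' = ?q \<omega>"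
    \<comment> \<open>By predictability the factor \<open>k\<close> of the product depends on \<open>\<omega> 0, \<dots>, \<omega> k\<close> only, and
      \<open>k \<le> n\<close>.\<close>
    proof (rule prod.cong[OF refl])
      fix k assume k: "k \<in> {1..n}"
      have "\<omega>' \<in> cylinder (k - 1) \<omega>" using * k by (auto simp: cylinder_def)
      moreover have "Q k \<in> borel_measurable (\<F> (k - 1))"
        using Q k by (simp add: predictable_transition_matrices_def)
      ultimately have "Q k \<omega>' = Q k \<omega>" by (metis \<F>_measurable_imp_constant_on_cylinder)
      then show "Q k \<omega>' $ \<omega>' (k - 1) $ \<omega>' k / A $ \<omega>' (k - 1) $ \<omega>' k =
          Q k \<omega> $ \<omega> (k - 1) $ \<omega> k / A $ \<omega> (k - 1) $ \<omega> k"
        using * k by (auto simp: cylinder_def)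
    qed
    ultimately show "(?f \<omega>' = ennreal (?q \<omega>')) = (?f \<omega> = ennreal (?q \<omega>))" by simp
  qed
  also have "\<dots> \<longleftrightarrow> (\<forall>\<omega>. measure P' (cylinder n \<omega>) > 0 \<longrightarrow>
      measure P (cylinder n \<omega>) = ?q \<omega> * measure P' (cylinder n \<omega>))"
  proof (intro all_cong1 imp_cong)
    fix \<omega> assume pos: "measure P' (cylinder n \<omega>) > 0"
    have "measure P (cylinder n \<omega>) = ?q \<omega> * measure P' (cylinder n \<omega>) \<longleftrightarrow>
      emeasure P (cylinder n \<omega>) = ennreal (?q \<omega>) * emeasure P' (cylinder n \<omega>)"
      using q[of \<omega>] by (simp add: P.emeasure_eq_measure P'.emeasure_eq_measure ennreal_mult[symmetric])
    also have "\<dots> \<longleftrightarrow> ?f \<omega> = ennreal (?q \<omega>)"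
      unfolding RN_deriv_on_cylinder[OF P P' ac, of n \<omega>]
      using pos by (simp add: ennreal_mult_cancel_left P'.emeasure_eq_measure
          mult.commute[where b = "ennreal (measure P' (cylinder n \<omega>))"])
    finally show "(?f \<omega> = ennreal (?q \<omega>)) =
      (measure P (cylinder n \<omega>) = ?q \<omega> * measure P' (cylinder n \<omega>))" ..
  qed (simp add: restr_to_\<F>[OF P'])
  finally show ?thesis .
qed

section \<open>The two parts of the theorem\<close>

text \<open>
  Both cylinder masses are products with the same initial factor. The product of the entries of
  \<open>A\<close> is positive, so a \<open>P'\<close>-null cylinder already has initial mass zero and is therefore
  \<open>P\<close>-null; for the same reason the two products can be divided.
\<close>

lemma direct_part:
  fixes P P' :: "(nat \<Rightarrow> 'n::finite) measure"
  assumes A: "\<And>i j. 0 < A $ i $ j"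
    and P: "path_prob P" and Q: "predictable_transition_matrices Q" and PQ: "markov_chain P Q"
    and P': "path_prob P'" and PA: "stationary_markov_chain P' A"
    and init: "same_initial_distribution P P'"
  shows "locally_absolutely_continuous P' P" and "density_formula P' P A Q n"
proof -
  have cyl0: "measure P (cylinder 0 \<omega>) = measure P' (cylinder 0 \<omega>)" for \<omega>
  proof -
    have "measure (distr R (count_space UNIV) (X 0)) {\<omega> 0} = measure R (cylinder 0 \<omega>)"
      if R: "path_prob R" for R :: "(nat \<Rightarrow> 'n) measure"
    proof -
      have sp: "space R = UNIV" using subalgebra_\<F>[OF R, of 0] by (simp add: subalgebra_def)
      have "X 0 \<in> measurable R (count_space UNIV)"
        using path_prob_coordinate_event[OF R, of 0]
        by (auto simp: measurable_count_space_eq2 X_def sp vimage_def)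
      then show ?thesis
        by (subst measure_distr) (auto simp: sp cylinder_def X_def vimage_def)
    qed
    from this[OF P] this[OF P'] init show ?thesis by (simp add: same_initial_distribution_def)
  qed
  have Qm: "Q (Suc n) \<in> borel_measurable (\<F> n)" for n
    using Q unfolding predictable_transition_matrices_def
    by (metis diff_Suc_1 le_add1 plus_1_eq_Suc)
  note cP = measure_cylinder_eq_prod[OF P Qm PQ]
  have cP': "measure P' (cylinder n \<omega>) =
      measure P' (cylinder 0 \<omega>) * (\<Prod>k=1..n. A $ \<omega> (k - 1) $ \<omega> k)" for n \<omega>
    by (rule measure_cylinder_eq_prod[OF P', of "\<lambda>_ _. A"])
       (use PA in \<open>auto simp: stationary_markov_chain_def\<close>)
  have pos: "(\<Prod>k=1..n. A $ \<omega> (k - 1) $ \<omega> k) > 0" for n and \<omega> :: "nat \<Rightarrow> 'n" by (intro prod_pos) (auto intro: A)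
  show ac: "locally_absolutely_continuous P' P"
    unfolding locally_absolutely_continuous_iff_cylinder[OF P P']
  proof (intro allI impI)
    fix n \<omega> assume "measure P' (cylinder n \<omega>) = 0"
    then have "measure P (cylinder 0 \<omega>) = 0"
      using cP'[of n \<omega>] pos[where n = n and \<omega> = \<omega>] cyl0[of \<omega>]
      by (metis less_irrefl mult_eq_0_iff)
    then show "measure P (cylinder n \<omega>) = 0" by (simp add: cP[of n])
  qed
  show "density_formula P' P A Q n"
    unfolding density_formula_iff_cylinder[OF P P' ac Q order.strict_implies_order[OF A]]
  proof (intro allI impI)
    fix \<omega>
    have "measure P (cylinder n \<omega>) = (\<Prod>k=1..n. Q k \<omega> $ \<omega> (k - 1) $ \<omega> k) * measure P' (cylinder 0 \<omega>)"
      using cP[of n \<omega>] cyl0[of \<omega>] by (simp only: mult.commute)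
    also have "\<dots> = (\<Prod>k=1..n. Q k \<omega> $ \<omega> (k - 1) $ \<omega> k) / (\<Prod>k=1..n. A $ \<omega> (k - 1) $ \<omega> k)
        * measure P' (cylinder n \<omega>)"
      unfolding cP'[of n \<omega>] using A by (simp add: less_imp_neq[symmetric])
    finally show "measure P (cylinder n \<omega>) =
        (\<Prod>k=1..n. Q k \<omega> $ \<omega> (k - 1) $ \<omega> k / A $ \<omega> (k - 1) $ \<omega> k) * measure P' (cylinder n \<omega>)"
      by (simp only: prod_dividef)
  qed
qed

text \<open>
  The entry \<open>(i, j)\<close> of \<open>Q n \<omega>\<close> is the conditional probability of \<open>X n = j\<close> given the cylinder of
  \<open>\<omega>\<close> up to time \<open>n - 1\<close>. That cylinder already determines the state \<open>X (n - 1)\<close>, so the Markov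
  property involves a single row of \<open>Q n \<omega>\<close>, and all rows may be taken equal. Where
  the quotient is undefined, any transition matrix serves, and \<open>A\<close> supplies one.
\<close>

lemma markov_chain_own_conditional_probabilities:
  fixes P :: "(nat \<Rightarrow> 'n::finite) measure"
  assumes P: "path_prob P" and A: "transition_matrix (A :: real^'n^'n)"
  obtains Q where "predictable_transition_matrices Q" "markov_chain P Q"
proof -
  interpret prob_space P using P by (simp add: path_prob_def)
  define Q :: "nat \<Rightarrow> (nat \<Rightarrow> 'n) \<Rightarrow> real^'n^'n" where
    "Q n \<omega> = (if measure P (cylinder (n - 1) \<omega>) = 0 then A
      else (\<chi> i j. measure P (cylinder (n - 1) \<omega> \<inter> {\<omega>'. \<omega>' n = j}) / measure P (cylinder (n - 1) \<omega>)))"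
    for n \<omega>
  have sum_p: "(\<Sum>j\<in>UNIV. measure P (cylinder m \<omega> \<inter> {\<omega>'. \<omega>' n = j})) = measure P (cylinder m \<omega>)" for m n \<omega>
  proof -
    have C: "cylinder m \<omega> \<in> sets P"
      using subalgebra_\<F>[OF P] cylinder_in_\<F>[of m \<omega>] by (auto simp: subalgebra_def)
    have "measure P (\<Union>j\<in>UNIV. cylinder m \<omega> \<inter> {\<omega>'. \<omega>' n = j}) =
        (\<Sum>j\<in>UNIV. measure P (cylinder m \<omega> \<inter> {\<omega>'. \<omega>' n = j}))"
      by (intro finite_measure_finite_Union)
         (auto simp: disjoint_family_on_def intro: C path_prob_coordinate_event[OF P])
    moreover have "(\<Union>j\<in>UNIV. cylinder m \<omega> \<inter> {\<omega>'. \<omega>' n = j}) = cylinder m \<omega>" by auto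
    ultimately show ?thesis by simp
  qed
  have "Q n \<in> borel_measurable (\<F> (n - 1))" for n
    by (rule constant_on_cylinders_imp_\<F>_measurable) (simp_all add: Q_def cylinder_eq)
  moreover have "transition_matrix (Q n \<omega>)" for n \<omega>
    using A by (auto simp: transition_matrix_def Q_def sum_p sum_divide_distrib[symmetric])
  ultimately have pred: "predictable_transition_matrices Q"
    by (simp add: predictable_transition_matrices_def)
  moreover have "markov_chain P Q"
  proof (subst markov_chain_iff_cylinder[OF P], safe)
    fix n show "Q (Suc n) \<in> borel_measurable (\<F> n)"
      using \<open>\<And>n. Q n \<in> borel_measurable (\<F> (n - 1))\<close>[of "Suc n"] by simp
  next
    fix n and \<omega> :: "nat \<Rightarrow> 'n"
    have "measure P (cylinder (Suc n) \<omega>) \<le> measure P (cylinder n \<omega>)"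
      using subalgebra_\<F>[OF P] cylinder_in_\<F>[of n \<omega>]
      by (intro finite_measure_mono) (auto simp: subalgebra_def cylinder_Suc)
    then show "measure P (cylinder (Suc n) \<omega>) =
        measure P (cylinder n \<omega>) * Q (Suc n) \<omega> $ \<omega> n $ \<omega> (Suc n)"
      using measure_nonneg[of P "cylinder (Suc n) \<omega>"] 
      by (auto simp: Q_def cylinder_Suc intro: order.antisym)
  qed
  ultimately show thesis by (rule that)
qed

theorem theorem2p1:
  fixes P\<^sub>0 :: "real^'n^'n"
  assumes "transition_matrix P\<^sub>0"
    and "\<And>i j. 0 < P\<^sub>0 $ i $ j"
  shows
    "(\<forall>(\<P> :: (nat \<Rightarrow> 'n) measure) (\<P>\<^sub>0 :: (nat \<Rightarrow> 'n) measure) P.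
        path_prob \<P> \<longrightarrow> predictable_transition_matrices P \<longrightarrow> markov_chain \<P> P \<longrightarrow>
        path_prob \<P>\<^sub>0 \<longrightarrow> stationary_markov_chain \<P>\<^sub>0 P\<^sub>0 \<longrightarrow> same_initial_distribution \<P> \<P>\<^sub>0 \<longrightarrow>
          locally_absolutely_continuous \<P>\<^sub>0 \<P> \<and> (\<forall>n. density_formula \<P>\<^sub>0 \<P> P\<^sub>0 P n))
   \<and> (\<forall>(\<P> :: (nat \<Rightarrow> 'n) measure) (\<P>\<^sub>0 :: (nat \<Rightarrow> 'n) measure).
        path_prob \<P> \<longrightarrow>
        path_prob \<P>\<^sub>0 \<longrightarrow> stationary_markov_chain \<P>\<^sub>0 P\<^sub>0 \<longrightarrow> same_initial_distribution \<P> \<P>\<^sub>0 \<longrightarrow>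
        locally_absolutely_continuous \<P>\<^sub>0 \<P> \<longrightarrow>
          (\<exists>P. predictable_transition_matrices P \<and> markov_chain \<P> P
             \<and> (\<forall>n. density_formula \<P>\<^sub>0 \<P> P\<^sub>0 P n)))"
proof (intro conjI allI impI)
  fix \<P> \<P>\<^sub>0 :: "(nat \<Rightarrow> 'n) measure" and P
  assume *: "path_prob \<P>" "predictable_transition_matrices P" "markov_chain \<P> P"
    "path_prob \<P>\<^sub>0" "stationary_markov_chain \<P>\<^sub>0 P\<^sub>0" "same_initial_distribution \<P> \<P>\<^sub>0"
  show "locally_absolutely_continuous \<P>\<^sub>0 \<P>"
    by (rule direct_part(1)[OF assms(2) *])
  show "density_formula \<P>\<^sub>0 \<P> P\<^sub>0 P n" for n
    by (rule direct_part(2)[OF assms(2) *])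
next
  fix \<P> \<P>\<^sub>0 :: "(nat \<Rightarrow> 'n) measure"
  assume *: "path_prob \<P>" "path_prob \<P>\<^sub>0" "stationary_markov_chain \<P>\<^sub>0 P\<^sub>0"
    "same_initial_distribution \<P> \<P>\<^sub>0"
  obtain P where "predictable_transition_matrices P" "markov_chain \<P> P"
    using markov_chain_own_conditional_probabilities[OF *(1) assms(1)] .
  with direct_part(2)[OF assms(2) *(1) this *(2-4)]
  show "\<exists>P. predictable_transition_matrices P \<and> markov_chain \<P> P
      \<and> (\<forall>n. density_formula \<P>\<^sub>0 \<P> P\<^sub>0 P n)"
    by blast
qed

end
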